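(* Let $k$ be a field of characteristic $p>0$ and let $m\ge 1$ be an integer. Then the following assertions hold. (1) $\mathfrak{H}(m+2,k[T]) \leadsto \daleth_{m+2}\cup\bigcup_{(\ell,r_1,r_2)\in\Omega_m} {}^{\ell}\mathfrak{H}^{r_1}_{r_2}$. (2) The two sets $\daleth_{m+2}$ and $\bigcup_{(\ell,r_1,r_2)\in\Omega_m} {}^{\ell}\mathfrak{H}^{r_1}_{r_2}$ are mutually $GL(m+2,k)$-disjoint.
   Context: $k[T]$ is the polynomial ring in one variable over $k$. For $x_1,\dots,x_m,y_1,\dots,y_m,z\in k[T]$, $\eta(x_1,\dots,x_m,y_1,\dots,y_m,z)\in \mathrm{Mat}(m+2,k[T])$ is the upper triangular matrix with all diagonal entries $1$, first row $(1,x_1,\dots,x_m,z)$, last column ${}^t(z,y_1,\dots,y_m,1)$, and all other off-diagonal entries $0$. $\mathfrak{H}(m+2,k[T])$ (the Heisenberg group) is the set of all such matrices. Below, $\eta(a_1,\dots,a_{2m+1})$ means $x_i=a_i$, $y_i=a_{m+i}$ $(1\le i\le m)$, $z=a_{2m+1}$. $\Omega_m:=\{(\ell,r_1,r_2)\in\mathbb{Z}^3\mid 1\le \ell\le m,\ 1\le r_1\le \ell,\ 0\le r_2\le m-\ell\}$. For $(\ell,r_1,r_2)\in\Omega_m$, ${}^{\ell}\mathfrak{H}^{r_1}_{r_2}$ is the set of all $\eta(a_1,\dots,a_{2m+1})\in\mathfrak{H}(m+2,k[T])$ such that: (i) $a_1,\dots,a_\ell$ are linearly independent over $k$; (ii)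 $a_{m+1},\dots,a_{m+r_1},a_{m+\ell+1},\dots,a_{m+\ell+r_2}$ are linearly independent over $k$; (iii) $a_i=0$ for all $i$ with $\ell+1\le i\le m$, or $m+r_1+1\le i\le m+\ell$, or $m+\ell+r_2+1\le i\le 2m$. For $1\le i\le m+1$, $\daleth_{m+2}^{(i)}$ is the set of all $\eta(a_1,\dots,a_{2m+1})\in\mathfrak{H}(m+2,k[T])$ such that $a_j=0$ whenever $j\notin\{i,i+1,\dots,m+i-1\}\cup\{2m+1\}$; and $\daleth_{m+2}:=\bigcup_{i=1}^{m+1}\daleth_{m+2}^{(i)}$. For subsets $S,S'$ of $\mathrm{Mat}(n,k[T])$, $S\leadsto S'$ means: for every $A(T)\in S$ there is $P\in GL(n,k)$ with $P^{-1}A(T)P\in S'$. Subsets $S_1,\dots,S_N$ of $\mathrm{Mat}(n,k[T])$ are mutually $GL(n,k)$-disjoint if $(PS_iP^{-1})\cap(P'S_jP'^{-1})=\emptyset$ for all $i\ne j$ and all $P,P'\in GL(n,k)$. *)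

theory Defs
  imports
    "HOL-Computational_Algebra.Polynomial"
    "Jordan_Normal_Form.Matrix"
begin

text \<open>
  The polynomial ring \<open>k[T]\<close> is the type \<open>'k poly\<close> with \<open>'k :: field\<close>; its \<open>k\<close>-vector space
  structure is given by \<^const>\<open>Polynomial.smult\<close>.
\<close>

interpretation poly_vs: vector_space "Polynomial.smult :: 'k :: field \<Rightarrow> 'k poly \<Rightarrow> 'k poly"
  by unfold_locales (simp_all add: smult_add_right smult_add_left)

text \<open>
  Linear independence over \<open>k\<close> of a family, as opposed to a set: repetitions make the family
  dependent.
\<close>

definition lin_indep_family :: "(nat \<Rightarrow> 'k :: field poly) \<Rightarrow> nat set \<Rightarrow> bool" where
  "lin_indep_family a I \<longleftrightarrow> inj_on a I \<and> poly_vs.independent (a ` I)"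

lemma lin_indep_family_iff:
  assumes "finite I"
  shows "lin_indep_family a I \<longleftrightarrow>
    (\<forall>c. (\<Sum>i\<in>I. Polynomial.smult (c i) (a i)) = 0 \<longrightarrow> (\<forall>i\<in>I. c i = 0))"
proof
  assume *: "lin_indep_family a I"
  hence inj: "inj_on a I" and ind: "poly_vs.independent (a ` I)"
    by (auto simp: lin_indep_family_def)
  show "\<forall>c. (\<Sum>i\<in>I. Polynomial.smult (c i) (a i)) = 0 \<longrightarrow> (\<forall>i\<in>I. c i = 0)"
  proof (intro allI impI ballI)
    fix c i assume s: "(\<Sum>i\<in>I. Polynomial.smult (c i) (a i)) = 0" and i: "i \<in> I"
    have "(\<Sum>v\<in>a ` I. Polynomial.smult (c (the_inv_into I a v)) v) = (\<Sum>i\<in>I. Polynomial.smult (c i) (a i))"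
      by (subst sum.reindex[OF inj]) (auto intro!: sum.cong simp: the_inv_into_f_f[OF inj])
    with s have "(\<Sum>v\<in>a ` I. Polynomial.smult (c (the_inv_into I a v)) v) = 0" by simp
    from poly_vs.independentD[OF ind _ _ this, of "a i"] assms i
    have "c (the_inv_into I a (a i)) = 0" by auto
    thus "c i = 0" using i by (simp add: the_inv_into_f_f[OF inj])
  qed
next
  assume *: "\<forall>c. (\<Sum>i\<in>I. Polynomial.smult (c i) (a i)) = 0 \<longrightarrow> (\<forall>i\<in>I. c i = 0)"
  have inj: "inj_on a I"
  proof (rule inj_onI, rule ccontr)
    fix x y assume xy: "x \<in> I" "y \<in> I" "a x = a y" "x \<noteq> y"
    define c :: "nat \<Rightarrow> 'a" where "c i = (if i = x then 1 else if i = y then - 1 else 0)" for i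
    have "(\<Sum>i\<in>I. Polynomial.smult (c i) (a i)) = (\<Sum>i\<in>{x, y}. Polynomial.smult (c i) (a i))"
      using assms xy by (intro sum.mono_neutral_right) (auto simp: c_def)
    also have "\<dots> = 0" using xy by (auto simp: c_def)
    finally have "c x = 0" using * xy by blast
    thus False by (simp add: c_def)
  qed
  have "poly_vs.independent (a ` I)"
  proof
    assume "poly_vs.dependent (a ` I)"
    then obtain u where u: "\<exists>v\<in>a ` I. u v \<noteq> 0" "(\<Sum>v\<in>a ` I. Polynomial.smult (u v) v) = 0"
      using assms by (auto simp: poly_vs.dependent_finite)
    have "(\<Sum>i\<in>I. Polynomial.smult (u (a i)) (a i)) = 0"
      using u(2) by (simp add: sum.reindex[OF inj])
    with * have "\<forall>i\<in>I. u (a i) = 0" by (auto dest: spec[of _ "\<lambda>i. u (a i)"])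
    with u(1) show False by auto
  qed
  with inj show "lin_indep_family a I" by (simp add: lin_indep_family_def)
qed


text \<open>
  Only the values \<open>x 1, \<dots>, x m\<close> and \<open>y 1, \<dots>, y m\<close> matter. Matrix indices start at \<open>0\<close>, so
  \<open>x j\<close> sits in row \<open>0\<close> and column \<open>j\<close>, and \<open>y i\<close> in row \<open>i\<close> and column \<open>m + 1\<close>.
\<close>

definition eta ::
    "nat \<Rightarrow> (nat \<Rightarrow> 'k :: field poly) \<Rightarrow> (nat \<Rightarrow> 'k poly) \<Rightarrow> 'k poly \<Rightarrow> 'k poly mat" where
  "eta m x y z = mat (m + 2) (m + 2) (\<lambda>(i, j).
     if i = j then 1
     else if i = 0 \<and> j = m + 1 then z
     else if i = 0 then x j
     else if j = m + 1 then y i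
     else 0)"

definition eta_seq :: "nat \<Rightarrow> (nat \<Rightarrow> 'k :: field poly) \<Rightarrow> 'k poly mat" where
  "eta_seq m a = eta m a (\<lambda>i. a (m + i)) (a (2 * m + 1))"

text \<open>The Heisenberg group \<open>H(m + 2, k[T])\<close>; the argument is \<open>m\<close>, not the matrix size.\<close>

definition heisenberg :: "nat \<Rightarrow> 'k :: field poly mat set" where
  "heisenberg m = {eta m x y z | x y z. True}"

definition Omega :: "nat \<Rightarrow> (nat \<times> nat \<times> nat) set" where
  "Omega m = {(l, r1, r2). 1 \<le> l \<and> l \<le> m \<and> 1 \<le> r1 \<and> r1 \<le> l \<and> r2 \<le> m - l}"

definition heisenberg_sub :: "nat \<Rightarrow> nat \<times> nat \<times> nat \<Rightarrow> 'k :: field poly mat set" where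
  "heisenberg_sub m = (\<lambda>(l, r1, r2). {eta_seq m a | a.
     lin_indep_family a {1..l} \<and>
     lin_indep_family a ({m + 1..m + r1} \<union> {m + l + 1..m + l + r2}) \<and>
     (\<forall>i \<in> {l + 1..m} \<union> {m + r1 + 1..m + l} \<union> {m + l + r2 + 1..2 * m}. a i = 0)})"

definition daleth_comp :: "nat \<Rightarrow> nat \<Rightarrow> 'k :: field poly mat set" where
  "daleth_comp m i = {eta_seq m a | a.
     \<forall>j \<in> {1..2 * m + 1}. j \<notin> {i..m + i - 1} \<union> {2 * m + 1} \<longrightarrow> a j = 0}"

definition daleth :: "nat \<Rightarrow> 'k :: field poly mat set" where
  "daleth m = (\<Union>i \<in> {1..m + 1}. daleth_comp m i)"


abbreviation GL :: "nat \<Rightarrow> 'k :: field mat set" where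
  "GL n \<equiv> Units (ring_mat TYPE('k) n ())"

abbreviation GL_inv :: "nat \<Rightarrow> 'k :: field mat \<Rightarrow> 'k mat" where
  "GL_inv n P \<equiv> inv\<^bsub>ring_mat TYPE('k) n ()\<^esub> P"

text \<open>The inclusion of \<open>Mat(n, k)\<close> into \<open>Mat(n, k[T])\<close> as constant matrices.\<close>

definition const_mat :: "'k :: field mat \<Rightarrow> 'k poly mat" where
  "const_mat P = map_mat (\<lambda>c. [:c:]) P"

text \<open>
  The following two notions are meant for subsets of \<open>carrier_mat n n\<close>.
\<close>

definition leads_to :: "nat \<Rightarrow> 'k :: field poly mat set \<Rightarrow> 'k poly mat set \<Rightarrow> bool" where
  "leads_to n S S' \<longleftrightarrow>
     (\<forall>A \<in> S. \<exists>P \<in> GL n. const_mat (GL_inv n P) * A * const_mat P \<in> S')"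

definition mutually_GL_disjoint :: "nat \<Rightarrow> 'k :: field poly mat set list \<Rightarrow> bool" where
  "mutually_GL_disjoint n Ss \<longleftrightarrow>
     (\<forall>i < length Ss. \<forall>j < length Ss. i \<noteq> j \<longrightarrow>
       (\<forall>P \<in> GL n. \<forall>P' \<in> GL n.
         (\<lambda>A. const_mat P * A * const_mat (GL_inv n P)) ` (Ss ! i) \<inter>
         (\<lambda>A. const_mat P' * A * const_mat (GL_inv n P')) ` (Ss ! j) = {}))"

lemma eta_carrier: "eta m x y z \<in> carrier_mat (m + 2) (m + 2)"
  by (simp add: eta_def)

lemma heisenberg_carrier: "heisenberg m \<subseteq> carrier_mat (m + 2) (m + 2)"
  unfolding heisenberg_def using eta_carrier by blast

lemma heisenberg_sub_subset: "heisenberg_sub m t \<subseteq> heisenberg m"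
  by (auto simp: heisenberg_sub_def heisenberg_def eta_seq_def split: prod.splits)

lemma daleth_subset: "daleth m \<subseteq> heisenberg m"
  by (auto simp: daleth_def daleth_comp_def heisenberg_def eta_seq_def)

end

theory Submission
  imports Defs "Jordan_Normal_Form.Determinant"
begin

text \<open>
  Among all conjugates of \<open>eta m x y z\<close> by constant block matrices \<open>diag(1, Q, 1)\<close>, choose one with
  as few nonzero \<open>x i\<close> as possible, and then as few nonzero \<open>y i\<close> as possible. A linear relation
  among the nonzero entries of \<open>x\<close> or of \<open>y\<close> would allow a transvection that decreases this count, so
  these entries are independent. If the supports of \<open>x\<close> and \<open>y\<close> are disjoint, a permutation of the
  coordinates leads to \<open>daleth m\<close>, and otherwise to \<open>heisenberg_sub m (l, r1, r2)\<close>, where \<open>l\<close> is the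
  size of the support of \<open>x\<close>, and \<open>r1 \<ge> 1\<close> and \<open>r2\<close> are the numbers of elements of the support of
  \<open>y\<close> inside and outside of it.

  Disjointness: let \<open>N_d\<close> be the coefficient of \<open>T^d\<close> in \<open>A - 1\<close>. That \<open>N_d N_e = 0\<close> for all \<open>d\<close> and
  \<open>e\<close> is invariant under conjugation by constant matrices. The only entry of \<open>N_d N_e\<close> that can be
  nonzero is the corner, where it is the sum of the products of the coefficients of \<open>x i\<close> and \<open>y i\<close>.
  It vanishes on \<open>daleth m\<close>, but not for all \<open>d\<close> and \<open>e\<close> on \<open>heisenberg_sub m (l, r1, r2)\<close>, since
  \<open>r1 \<ge> 1\<close>.
\<close>

subsection \<open>Conjugation by constant matrices\<close>

lemma GL_D:
  fixes P :: "'k :: field mat"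
  assumes "P \<in> GL n"
  shows "P \<in> carrier_mat n n" "GL_inv n P \<in> carrier_mat n n"
    "P * GL_inv n P = 1\<^sub>m n" "GL_inv n P * P = 1\<^sub>m n" "GL_inv n P \<in> GL n"
proof -
  interpret R: ring "ring_mat TYPE('k) n ()" by (rule ring_mat)
  show "P \<in> carrier_mat n n" "GL_inv n P \<in> carrier_mat n n"
    "P * GL_inv n P = 1\<^sub>m n" "GL_inv n P * P = 1\<^sub>m n" "GL_inv n P \<in> GL n"
    using R.Units_closed[OF assms] R.Units_inv_closed[OF assms] R.Units_r_inv[OF assms]
      R.Units_l_inv[OF assms] R.Units_inv_Units[OF assms]
    by (simp_all add: ring_mat_simps)
qed

lemma GL_I:
  fixes P Q :: "'k :: field mat"
  assumes "P \<in> carrier_mat n n" "Q \<in> carrier_mat n n" "P * Q = 1\<^sub>m n"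
  shows "P \<in> GL n"
  using assms mat_mult_left_right_inverse[OF assms]
  by (auto simp: Units_def ring_mat_simps)

lemma GL_mult:
  fixes P Q :: "'k :: field mat"
  assumes "P \<in> GL n" "Q \<in> GL n"
  shows "P * Q \<in> GL n"
proof -
  interpret R: ring "ring_mat TYPE('k) n ()" by (rule ring_mat)
  show ?thesis using R.Units_m_closed[OF assms] by (simp add: ring_mat_simps)
qed

lemma const_poly_sum: "[:\<Sum>i\<in>I. f i:] = (\<Sum>i\<in>I. [:f i:])"
proof (induction I rule: infinite_finite_induct)
  case (insert i I)
  then show ?case by (simp flip: insert.IH)
qed simp_all

lemma const_mat_carrier [simp]: "const_mat P \<in> carrier_mat n m \<longleftrightarrow> P \<in> carrier_mat n m"
  by (simp add: const_mat_def)

lemma const_mat_one: "const_mat (1\<^sub>m n) = 1\<^sub>m n"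
  by (rule eq_matI) (auto simp: const_mat_def one_pCons)

lemma const_mat_mult:
  assumes "P \<in> carrier_mat n m" "Q \<in> carrier_mat m l"
  shows "const_mat (P * Q) = const_mat P * const_mat Q"
  using assms
  by (intro eq_matI) (auto simp: const_mat_def scalar_prod_def const_poly_sum intro!: sum.cong)

lemma const_mat_GL:
  assumes "P \<in> GL n"
  shows "const_mat P \<in> carrier_mat n n" "const_mat (GL_inv n P) \<in> carrier_mat n n"
    "const_mat P * const_mat (GL_inv n P) = 1\<^sub>m n"
    "const_mat (GL_inv n P) * const_mat P = 1\<^sub>m n"
  using GL_D[OF assms]
  by (auto simp: const_mat_one simp flip: const_mat_mult[of _ n n _ n])

text \<open>Similarity written without the inverse, so that checking it means comparing two
  products; \<open>GL_conjugate_leads\<close> brings the inverse back.\<close>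

definition GL_conjugate :: "nat \<Rightarrow> 'k :: field poly mat \<Rightarrow> 'k poly mat \<Rightarrow> bool" where
  "GL_conjugate n A B \<longleftrightarrow> (\<exists>P \<in> GL n. A * const_mat P = const_mat P * B)"

lemma GL_conjugate_refl:
  assumes "A \<in> carrier_mat n n"
  shows "GL_conjugate n A A"
proof -
  have "1\<^sub>m n \<in> GL n" by (rule GL_I[of _ _ "1\<^sub>m n"]) auto
  then show ?thesis
    unfolding GL_conjugate_def using assms
    by (intro bexI[of _ "1\<^sub>m n"]) (simp_all add: const_mat_one)
qed

lemma GL_conjugate_trans:
  assumes AB: "GL_conjugate n A B" and BC: "GL_conjugate n B C"
    and car: "A \<in> carrier_mat n n" "B \<in> carrier_mat n n" "C \<in> carrier_mat n n"
  shows "GL_conjugate n A C"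
proof -
  obtain P where P: "P \<in> GL n" "A * const_mat P = const_mat P * B"
    using AB by (auto simp: GL_conjugate_def)
  obtain Q where Q: "Q \<in> GL n" "B * const_mat Q = const_mat Q * C"
    using BC by (auto simp: GL_conjugate_def)
  note [simp] = GL_D(1)[OF P(1)] GL_D(1)[OF Q(1)]
  have "A * const_mat (P * Q) = A * const_mat P * const_mat Q"
    using car by (simp add: const_mat_mult[of _ n n _ n] assoc_mult_mat[of _ n n _ n _ n])
  also have "\<dots> = const_mat P * (B * const_mat Q)"
    using car P by (simp add: assoc_mult_mat[of _ n n _ n _ n])
  also have "\<dots> = const_mat (P * Q) * C"
    using car Q by (simp add: const_mat_mult[of _ n n _ n] assoc_mult_mat[of _ n n _ n _ n])
  finally show ?thesis using GL_mult P(1) Q(1) by (auto simp: GL_conjugate_def)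
qed

lemma GL_conjugate_leads:
  assumes "GL_conjugate n A B" and car: "A \<in> carrier_mat n n" "B \<in> carrier_mat n n"
  shows "\<exists>P \<in> GL n. const_mat (GL_inv n P) * A * const_mat P = B"
proof -
  obtain P where P: "P \<in> GL n" "A * const_mat P = const_mat P * B"
    using assms by (auto simp: GL_conjugate_def)
  note c = const_mat_GL[OF P(1)]
  have "const_mat (GL_inv n P) * A * const_mat P = const_mat (GL_inv n P) * (const_mat P * B)"
    using assoc_mult_mat[OF c(2) car(1) c(1)] P(2) by simp
  also have "\<dots> = B"
    using assoc_mult_mat[OF c(2) c(1) car(2)] c(4) car by simp
  finally show ?thesis using P(1) by blast
qed

subsection \<open>The invariant separating the two families\<close>

definition coeff_mat :: "nat \<Rightarrow> 'k :: field poly mat \<Rightarrow> 'k mat" where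
  "coeff_mat d A = map_mat (\<lambda>f. coeff f d) A"

lemma coeff_mat_carrier [simp]: "coeff_mat d A \<in> carrier_mat n m \<longleftrightarrow> A \<in> carrier_mat n m"
  by (simp add: coeff_mat_def)

text \<open>A constant polynomial multiplies each coefficient separately, so extracting the
  coefficient of T^d commutes with multiplication by constant matrices on either side.\<close>

lemma coeff_const_mat_mult:
  assumes "P \<in> carrier_mat n n" "A \<in> carrier_mat n n"
  shows "coeff_mat d (const_mat P * A) = P * coeff_mat d A"
    and "coeff_mat d (A * const_mat P) = coeff_mat d A * P"
  using assms
  by (auto intro!: eq_matI sum.cong simp: coeff_mat_def const_mat_def scalar_prod_def coeff_sum)

text \<open>With N = A - 1, asking for all pairs d, e amounts to N(S) N(T) = 0 in two independent
  variables. The condition N(T)^2 = 0 would be too weak: for m = 2, x = (1, T) and y = (T, -1)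
  satisfy it although both families are independent.\<close>

definition coeffs_square_zero :: "nat \<Rightarrow> 'k :: field poly mat \<Rightarrow> bool" where
  "coeffs_square_zero n A \<longleftrightarrow>
     (\<forall>d e. coeff_mat d (A - 1\<^sub>m n) * coeff_mat e (A - 1\<^sub>m n) = 0\<^sub>m n n)"

text \<open>Conjugation by P fixes the identity and turns every N_d into P N_d P^-1, so in each
  product the inner factors P^-1 P cancel.\<close>

lemma coeffs_square_zero_conjugate:
  assumes "coeffs_square_zero n A" and A: "A \<in> carrier_mat n n" and P: "P \<in> GL n"
  shows "coeffs_square_zero n (const_mat P * A * const_mat (GL_inv n P))"
proof -
  note g = GL_D[OF P] note c = const_mat_GL[OF P]
  define N where "N = A - 1\<^sub>m n"
  have N: "N \<in> carrier_mat n n" using A by (auto simp: N_def)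
  have "const_mat P * A * const_mat (GL_inv n P) - 1\<^sub>m n
      = const_mat P * N * const_mat (GL_inv n P)"
    unfolding N_def using A c
    by (simp add: mult_minus_distrib_mat[of _ n n _ n] minus_mult_distrib_mat[of _ n n _ _ n])
  then have co: "coeff_mat d (const_mat P * A * const_mat (GL_inv n P) - 1\<^sub>m n)
      = P * coeff_mat d N * GL_inv n P" for d
    using N c g by (simp add: coeff_const_mat_mult[of _ n])
  have "P * coeff_mat d N * GL_inv n P * (P * coeff_mat e N * GL_inv n P) = 0\<^sub>m n n" for d e
  proof -
    let ?D = "coeff_mat d N" and ?E = "coeff_mat e N" and ?Q = "GL_inv n P"
    have cc: "?D \<in> carrier_mat n n" "?E \<in> carrier_mat n n" using N by auto
    have "P * ?D * ?Q * (P * ?E * ?Q) = P * (?D * ((?Q * P) * (?E * ?Q)))"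
      using cc g(1,2) by (simp add: assoc_mult_mat[of _ n n _ n _ n])
    also have "\<dots> = P * ((?D * ?E) * ?Q)"
      using cc g by (simp add: assoc_mult_mat[of _ n n _ n _ n])
    also have "\<dots> = 0\<^sub>m n n"
      using assms(1) g by (simp add: coeffs_square_zero_def N_def)
    finally show ?thesis .
  qed
  then show ?thesis by (simp add: coeffs_square_zero_def co)
qed

lemma sum_corner_split:
  fixes f :: "nat \<Rightarrow> 'a :: comm_monoid_add"
  shows "(\<Sum>h = 0..<m + 2. f h) = f 0 + (\<Sum>h = 1..m. f h) + f (m + 1)"
proof -
  have "{0..<m + 2} = insert 0 (insert (m + 1) {1..m})" by auto
  then show ?thesis by (simp add: ac_simps)
qed

lemma index_mult_mat_corner_split:
  assumes "A \<in> carrier_mat (m + 2) (m + 2)" "B \<in> carrier_mat (m + 2) (m + 2)" "i < m + 2" "j < m + 2"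
  shows "(A * B) $$ (i, j) = A $$ (i, 0) * B $$ (0, j) + (\<Sum>h = 1..m. A $$ (i, h) * B $$ (h, j))
    + A $$ (i, m + 1) * B $$ (m + 1, j)"
proof -
  have "(A * B) $$ (i, j) = (\<Sum>h = 0..<m + 2. A $$ (i, h) * B $$ (h, j))"
    using assms by (simp add: scalar_prod_def)
  then show ?thesis by (simp only: sum_corner_split)
qed

lemma coeffs_square_zero_daleth:
  assumes "A \<in> daleth m"
  shows "coeffs_square_zero (m + 2) A"
proof -
  obtain i a where A: "A = eta_seq m a"
    and a0: "\<And>j. j \<in> {1..2 * m + 1} \<Longrightarrow> j \<notin> {i..m + i - 1} \<union> {2 * m + 1} \<Longrightarrow> a j = 0"
    using assms unfolding daleth_def daleth_comp_def by blast
  \<comment> \<open>The window of allowed nonzero indices has length m, while h and m + h differ by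
    m, so it misses at least one of them.\<close>
  have z: "a h = 0 \<or> a (m + h) = 0" if "h \<in> {1..m}" for h
    using that a0[of h] a0[of "m + h"] by fastforce
  \<comment> \<open>For h = 0 the column and for h = m + 1 the row of A - 1 vanishes; for h in
    between, the only critical pair of entries is \<open>a h\<close> and
    \<open>a (m + h)\<close>.\<close>
  have 0: "(A - 1\<^sub>m (m + 2)) $$ (r, h) = 0 \<or> (A - 1\<^sub>m (m + 2)) $$ (h, s) = 0"
    if "r < m + 2" "h < m + 2" "s < m + 2" for r h s
    using that z[of h] by (auto simp: A eta_seq_def eta_def)
  have Ac: "A \<in> carrier_mat (m + 2) (m + 2)" unfolding A eta_seq_def by (rule eta_carrier)
  show ?thesis
    unfolding coeffs_square_zero_def
  proof (intro allI eq_matI)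
    fix d e r s assume "r < dim_row (0\<^sub>m (m + 2) (m + 2))" "s < dim_col (0\<^sub>m (m + 2) (m + 2))"
    then have rs: "r < m + 2" "s < m + 2" by auto
    have "(coeff_mat d (A - 1\<^sub>m (m + 2)) * coeff_mat e (A - 1\<^sub>m (m + 2))) $$ (r, s)
        = (\<Sum>h = 0..<m + 2. coeff ((A - 1\<^sub>m (m + 2)) $$ (r, h)) d
            * coeff ((A - 1\<^sub>m (m + 2)) $$ (h, s)) e)"
      using Ac rs by (simp add: coeff_mat_def scalar_prod_def)
    also have "\<dots> = 0"
    proof (intro sum.neutral ballI)
      fix h assume "h \<in> {0..<m + 2}"
      then show "coeff ((A - 1\<^sub>m (m + 2)) $$ (r, h)) d * coeff ((A - 1\<^sub>m (m + 2)) $$ (h, s)) e = 0"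
        using 0[of r h s] rs by (metis atLeastLessThan_iff coeff_0 mult_zero_left mult_zero_right)
    qed
    finally show "(coeff_mat d (A - 1\<^sub>m (m + 2)) * coeff_mat e (A - 1\<^sub>m (m + 2))) $$ (r, s)
        = 0\<^sub>m (m + 2) (m + 2) $$ (r, s)" using rs by simp
  qed (use Ac in \<open>auto simp: coeff_mat_def\<close>)
qed

lemma not_coeffs_square_zero_heisenberg_sub:
  assumes "t \<in> Omega m" "A \<in> heisenberg_sub m t"
  shows "\<not> coeffs_square_zero (m + 2) A"
proof
  assume sq: "coeffs_square_zero (m + 2) A"
  obtain l r1 r2 where t: "t = (l, r1, r2)" and b: "1 \<le> l" "l \<le> m" "1 \<le> r1" "r1 \<le> l" "r2 \<le> m - l"
    using assms(1) by (auto simp: Omega_def)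
  obtain a where A: "A = eta_seq m a" and ix: "lin_indep_family a {1..l}"
    and iy: "lin_indep_family a ({m + 1..m + r1} \<union> {m + l + 1..m + l + r2})"
    and a0: "\<And>i. i \<in> {l + 1..m} \<union> {m + r1 + 1..m + l} \<union> {m + l + r2 + 1..2 * m} \<Longrightarrow> a i = 0"
    using assms(2) unfolding t heisenberg_sub_def by auto
  have Ac: "A \<in> carrier_mat (m + 2) (m + 2)" unfolding A eta_seq_def by (rule eta_carrier)
  \<comment> \<open>This is the corner entry of N_d N_e.\<close>
  have s: "(\<Sum>h = 1..m. coeff (a h) d * coeff (a (m + h)) e) = 0" for d e
  proof -
    have "0 = (coeff_mat d (A - 1\<^sub>m (m + 2)) * coeff_mat e (A - 1\<^sub>m (m + 2))) $$ (0, m + 1)"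
      using sq by (simp add: coeffs_square_zero_def)
    also have "\<dots> = (\<Sum>h = 0..<m + 2. coeff ((A - 1\<^sub>m (m + 2)) $$ (0, h)) d
        * coeff ((A - 1\<^sub>m (m + 2)) $$ (h, m + 1)) e)"
      using Ac by (auto simp: coeff_mat_def scalar_prod_def intro!: sum.cong)
    also have "\<dots> = (\<Sum>h = 1..m. coeff ((A - 1\<^sub>m (m + 2)) $$ (0, h)) d
        * coeff ((A - 1\<^sub>m (m + 2)) $$ (h, m + 1)) e)"
      unfolding sum_corner_split by (simp add: A eta_seq_def eta_def)
    also have "\<dots> = (\<Sum>h = 1..m. coeff (a h) d * coeff (a (m + h)) e)"
      by (intro sum.cong) (auto simp: A eta_seq_def eta_def)
    finally show ?thesis by simp
  qed
  let ?J = "{m + 1..m + r1} \<union> {m + l + 1..m + l + r2}"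
  have "coeff (a 1) d = 0" for d
  proof -
    \<comment> \<open>For fixed d, the identities \<open>s\<close> for all e say that the y-entries,
      weighted by the T^d coefficients of the x-entries, sum to zero. This relation lives on
      \<open>?J\<close>, so independence there makes the weights on \<open>?J\<close>
      vanish.\<close>
    have "(\<Sum>j\<in>?J. Polynomial.smult (coeff (a (j - m)) d) (a j))
        = (\<Sum>j = m + 1..m + m. Polynomial.smult (coeff (a (j - m)) d) (a j))"
      using b by (intro sum.mono_neutral_left) (auto simp: a0)
    also have "\<dots> = (\<Sum>h = 1..m. Polynomial.smult (coeff (a h) d) (a (m + h)))"
      by (rule sum.reindex_bij_witness[of _ "\<lambda>h. m + h" "\<lambda>j. j - m"]) auto
    also have "\<dots> = 0" by (rule poly_eqI) (use s in \<open>simp add: coeff_sum\<close>)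
    finally have "coeff (a (j - m)) d = 0" if "j \<in> ?J" for j
      using iy[unfolded lin_indep_family_iff[OF finite_UnI[OF finite_atLeastAtMost finite_atLeastAtMost]],
          THEN spec, of "\<lambda>j. coeff (a (j - m)) d"] that by blast
    \<comment> \<open>This is where r1 >= 1 enters: the weight at m + 1 is a coefficient of
      \<open>a 1\<close>.\<close>
    moreover have "m + 1 \<in> ?J" using b by auto
    ultimately show ?thesis by fastforce
  qed
  then have "a 1 = 0" by (intro poly_eqI) simp
  moreover have "0 \<notin> a ` {1..l}"
    using ix poly_vs.dependent_zero unfolding lin_indep_family_def by blast
  ultimately show False using b by force
qed

lemma mutually_GL_disjoint_daleth_heisenberg_sub:
  "mutually_GL_disjoint (m + 2)
     [daleth m :: 'k :: field poly mat set, \<Union>t \<in> Omega m. heisenberg_sub m t]"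
proof -
  let ?n = "m + 2"
  have "const_mat P * A * const_mat (GL_inv ?n P) \<noteq> const_mat P' * B * const_mat (GL_inv ?n P')"
    if PP: "P \<in> GL ?n" "P' \<in> GL ?n" and A: "A \<in> daleth m"
      and B: "t \<in> Omega m" "B \<in> heisenberg_sub m t" for A B :: "'k poly mat" and P P' t
  proof
    assume eq: "const_mat P * A * const_mat (GL_inv ?n P) = const_mat P' * B * const_mat (GL_inv ?n P')"
    have Ac: "A \<in> carrier_mat ?n ?n" and Bc: "B \<in> carrier_mat ?n ?n"
      using A B daleth_subset heisenberg_sub_subset heisenberg_carrier by blast+
    note c = const_mat_GL[OF PP(1)] and c' = const_mat_GL[OF PP(2)]
    interpret R: ring "ring_mat TYPE('k) ?n ()" by (rule ring_mat)
    have inv_inv: "GL_inv ?n (GL_inv ?n P') = P'"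
      using PP(2) by (rule R.Units_inv_inv)
    have "coeffs_square_zero ?n (const_mat P' * B * const_mat (GL_inv ?n P'))"
      using coeffs_square_zero_conjugate[OF coeffs_square_zero_daleth[OF A] Ac PP(1)] eq by simp
    \<comment> \<open>The property was carried from A to the common conjugate; conjugating by the
      inverse of P' now carries it on to B.\<close>
    then have "coeffs_square_zero ?n (const_mat (GL_inv ?n P')
        * (const_mat P' * B * const_mat (GL_inv ?n P')) * const_mat P')"
      using coeffs_square_zero_conjugate[OF _ _ GL_D(5)[OF PP(2)]] Bc c'(1,2)
      by (metis inv_inv mult_carrier_mat)
    also have "const_mat (GL_inv ?n P') * (const_mat P' * B * const_mat (GL_inv ?n P')) * const_mat P'
        = (const_mat (GL_inv ?n P') * const_mat P') * B * (const_mat (GL_inv ?n P') * const_mat P')"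
      using Bc c'(1,2) by (simp add: assoc_mult_mat[of _ ?n ?n _ ?n _ ?n])
    also have "\<dots> = B" using c'(4) Bc by simp
    finally show False using not_coeffs_square_zero_heisenberg_sub[OF B] by simp
  qed
  then show ?thesis
    unfolding mutually_GL_disjoint_def
    by (fastforce simp: less_Suc_eq)
qed

subsection \<open>Changes of basis in the Heisenberg group\<close>

definition inner_block :: "nat \<Rightarrow> (nat \<Rightarrow> nat \<Rightarrow> 'k :: field) \<Rightarrow> 'k mat" where
  "inner_block m q = mat (m + 2) (m + 2) (\<lambda>(i, j).
     if i \<in> {1..m} \<and> j \<in> {1..m} then q i j else if i = j then 1 else 0)"

lemma inner_block_carrier [simp]: "inner_block m q \<in> carrier_mat (m + 2) (m + 2)"
  by (simp add: inner_block_def)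

lemma index_inner_block:
  "i \<in> {1..m} \<Longrightarrow> j \<in> {1..m} \<Longrightarrow> inner_block m q $$ (i, j) = q i j"
  "j < m + 2 \<Longrightarrow> inner_block m q $$ (0, j) = (if j = 0 then 1 else 0)"
  "j < m + 2 \<Longrightarrow> inner_block m q $$ (Suc m, j) = (if j = Suc m then 1 else 0)"
  "i < m + 2 \<Longrightarrow> inner_block m q $$ (i, 0) = (if i = 0 then 1 else 0)"
  "i < m + 2 \<Longrightarrow> inner_block m q $$ (i, Suc m) = (if i = Suc m then 1 else 0)"
  by (simp_all add: inner_block_def)

lemma corner_cases:
  assumes "i < m + (2::nat)"
  obtains "i = 0" | "i \<in> {1..m}" | "i = Suc m"
  using assms by fastforce

lemma inner_block_inverse:
  assumes "\<And>i j. i \<in> {1..m} \<Longrightarrow> j \<in> {1..m} \<Longrightarrow>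
    (\<Sum>h = 1..m. q i h * r h j) = (if i = j then 1 else 0)"
  shows "inner_block m q * inner_block m r = 1\<^sub>m (m + 2)"
proof (rule eq_matI)
  fix i j assume "i < dim_row (1\<^sub>m (m + 2))" "j < dim_col (1\<^sub>m (m + 2))"
  then have ij: "i < m + 2" "j < m + 2" by auto
  let ?s = "\<Sum>h = 1..m. inner_block m q $$ (i, h) * inner_block m r $$ (h, j)"
  have s: "?s = (if i \<in> {1..m} \<and> i = j then 1 else 0)"
  proof (cases "i \<in> {1..m} \<and> j \<in> {1..m}")
    case True
    then have "?s = (\<Sum>h = 1..m. q i h * r h j)"
      by (intro sum.cong) (simp_all add: index_inner_block(1))
    with True show ?thesis using assms[of i j] by simp
  next
    case False
    then have "i = 0 \<or> i = Suc m \<or> j = 0 \<or> j = Suc m" using ij by auto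
    then have "?s = 0"
      using ij by (intro sum.neutral) (auto simp: index_inner_block)
    with False show ?thesis by auto
  qed
  show "(inner_block m q * inner_block m r) $$ (i, j) = 1\<^sub>m (m + 2) $$ (i, j)"
    unfolding index_mult_mat_corner_split[OF inner_block_carrier inner_block_carrier ij] s
    using ij(1)
  proof (cases i rule: corner_cases)
  qed (use ij in \<open>simp_all add: index_inner_block\<close>)
qed (simp_all add: inner_block_def)

lemma index_eta:
  "eta m x y z $$ (0, 0) = 1"
  "j \<in> {1..m} \<Longrightarrow> eta m x y z $$ (0, j) = x j"
  "eta m x y z $$ (0, Suc m) = z"
  "i \<in> {1..m} \<Longrightarrow> eta m x y z $$ (i, 0) = 0"
  "i \<in> {1..m} \<Longrightarrow> j \<in> {1..m} \<Longrightarrow> eta m x y z $$ (i, j) = (if i = j then 1 else 0)"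
  "i \<in> {1..m} \<Longrightarrow> eta m x y z $$ (i, Suc m) = y i"
  "j < m + 2 \<Longrightarrow> eta m x y z $$ (Suc m, j) = (if j = Suc m then 1 else 0)"
  by (auto simp: eta_def)

lemma index_const_mat_inner_block:
  "i < m + 2 \<Longrightarrow> j < m + 2 \<Longrightarrow> const_mat (inner_block m q) $$ (i, j) = [:inner_block m q $$ (i, j):]"
  by (simp add: const_mat_def inner_block_def)

text \<open>Under conjugation by diag(1, Q, 1) the row x becomes x Q and the column y becomes Q^-1
  y, while the identity block and z stay. The condition on y is stated as y = Q y', so that
  comparing the two products involves only Q; \<open>r\<close> serves to make Q invertible.\<close>

lemma eta_conjugate:
  assumes inv: "\<And>i j. i \<in> {1..m} \<Longrightarrow> j \<in> {1..m} \<Longrightarrow>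
      (\<Sum>h = 1..m. q i h * r h j) = (if i = j then 1 else 0)"
    and x': "\<And>j. j \<in> {1..m} \<Longrightarrow> x' j = (\<Sum>i = 1..m. Polynomial.smult (q i j) (x i))"
    and y: "\<And>i. i \<in> {1..m} \<Longrightarrow> y i = (\<Sum>j = 1..m. Polynomial.smult (q i j) (y' j))"
  shows "GL_conjugate (m + 2) (eta m x y z) (eta m x' y' z)"
proof -
  let ?P = "inner_block m q"
  have "?P \<in> GL (m + 2)"
    by (rule GL_I[OF inner_block_carrier inner_block_carrier inner_block_inverse[OF inv]])
  moreover have "eta m x y z * const_mat ?P = const_mat ?P * eta m x' y' z"
  proof (rule eq_matI)
    fix i j assume "i < dim_row (const_mat ?P * eta m x' y' z)" "j < dim_col (const_mat ?P * eta m x' y' z)"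
    then have ij: "i < m + 2" "j < m + 2" by (auto simp: const_mat_def inner_block_def eta_def)
    let ?L = "\<lambda>h. eta m x y z $$ (i, h) * const_mat ?P $$ (h, j)"
    let ?R = "\<lambda>h. const_mat ?P $$ (i, h) * eta m x' y' z $$ (h, j)"
    have L: "(eta m x y z * const_mat ?P) $$ (i, j) = ?L 0 + (\<Sum>h = 1..m. ?L h) + ?L (m + 1)"
      using ij by (intro index_mult_mat_corner_split eta_carrier inner_block_carrier
          const_mat_carrier[THEN iffD2])
    have R: "(const_mat ?P * eta m x' y' z) $$ (i, j) = ?R 0 + (\<Sum>h = 1..m. ?R h) + ?R (m + 1)"
      using ij by (intro index_mult_mat_corner_split eta_carrier inner_block_carrier
          const_mat_carrier[THEN iffD2])
    note ind = index_eta index_const_mat_inner_block index_inner_block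
    \<comment> \<open>The inner sums are computed block by block: both give Q in the middle, the
      left one gives x Q in the first row, the right one gives Q y' in the last column, and the
      facts \<open>L0\<close> and \<open>R0\<close> cover vanishing inner sums on the
      border.\<close>
    have mid: "(\<Sum>h = 1..m. ?L h) = [:q i j:]" "(\<Sum>h = 1..m. ?R h) = [:q i j:]"
      if "i \<in> {1..m}" "j \<in> {1..m}"
    proof -
      have "(\<Sum>h = 1..m. ?L h) = (\<Sum>h = 1..m. if h = i then [:q i j:] else 0)"
        using that by (intro sum.cong) (simp_all add: ind)
      then show "(\<Sum>h = 1..m. ?L h) = [:q i j:]" using that by simp
      have "(\<Sum>h = 1..m. ?R h) = (\<Sum>h = 1..m. if h = j then [:q i j:] else 0)"
        using that by (intro sum.cong) (simp_all add: ind)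
      then show "(\<Sum>h = 1..m. ?R h) = [:q i j:]" using that by simp
    qed
    have top: "(\<Sum>h = 1..m. ?L h) = x' j" if "i = 0" "j \<in> {1..m}"
      unfolding x'[OF that(2)] using that by (intro sum.cong) (simp_all add: ind)
    have right: "(\<Sum>h = 1..m. ?R h) = y i" if "i \<in> {1..m}" "j = Suc m"
      unfolding y[OF that(1)] using that by (intro sum.cong) (simp_all add: ind)
    have L0: "(\<Sum>h = 1..m. ?L h) = 0" if "i = Suc m \<or> j = 0 \<or> j = Suc m"
      using that ij by (intro sum.neutral) (auto simp: ind)
    have R0: "(\<Sum>h = 1..m. ?R h) = 0" if "i = Suc m \<or> i = 0 \<or> j = 0"
      using that ij by (intro sum.neutral) (auto simp: ind)
    have "?L 0 + (\<Sum>h = 1..m. ?L h) + ?L (m + 1) = ?R 0 + (\<Sum>h = 1..m. ?R h) + ?R (m + 1)"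
      using ij(1)
    proof (cases i rule: corner_cases)
      case 1
      show ?thesis using ij(2)
      proof (cases j rule: corner_cases)
        case 2
        show ?thesis
          unfolding top[OF 1 2] R0[OF disjI2, OF disjI1, OF 1] using 1 2 by (simp add: ind)
      qed (use 1 L0 R0 in \<open>simp_all add: ind\<close>)
    next
      case 2
      show ?thesis using ij(2)
      proof (cases j rule: corner_cases)
        case 1
        show ?thesis
          unfolding L0[OF disjI2, OF disjI1, OF 1] R0[OF disjI2, OF disjI2, OF 1] using 1 2
          by (simp add: ind)
      next
        case j: 2
        show ?thesis unfolding mid[OF 2 j] using j 2 by (simp add: ind)
      next
        case 3
        show ?thesis
          unfolding right[OF 2 3] L0[OF disjI2, OF disjI2, OF 3] using 2 3 by (simp add: ind)
      qed
    next
      case 3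
      show ?thesis
        unfolding L0[OF disjI1, OF 3] R0[OF disjI1, OF 3] using ij(2) 3
        by (cases j rule: corner_cases) (simp_all add: ind)
    qed
    then show "(eta m x y z * const_mat ?P) $$ (i, j) = (const_mat ?P * eta m x' y' z) $$ (i, j)"
      unfolding L R .
  qed (auto simp: const_mat_def inner_block_def eta_def)
  ultimately show ?thesis by (auto simp: GL_conjugate_def)
qed

text \<open>Here Q = 1 + c e_j^T. Since c_j = 0, the rank-one part squares to zero and the inverse
  is 1 - c e_j^T.\<close>

lemma eta_conjugate_transvection:
  assumes j: "j \<in> {1..m}" and cj: "c j = 0"
  shows "GL_conjugate (m + 2) (eta m x y z)
    (eta m (x(j := x j + (\<Sum>i = 1..m. Polynomial.smult (c i) (x i))))
       (\<lambda>i. y i - Polynomial.smult (c i) (y j)) z)"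
proof (rule eta_conjugate[where q = "\<lambda>a b. (if a = b then 1 else 0) + (if b = j then c a else 0)"
      and r = "\<lambda>a b. (if a = b then 1 else 0) - (if b = j then c a else 0)"])
  fix a b assume ab: "a \<in> {1..m}" "b \<in> {1..m}"
  have "(\<Sum>h = 1..m. ((if a = h then 1 else 0) + (if h = j then c a else 0))
        * ((if h = b then 1 else 0) - (if b = j then c h else 0)))
      = (\<Sum>h = 1..m. (if h = a then (if a = b then 1 else 0) - (if b = j then c a else 0) else 0)
          + (if h = j then c a * (if b = j then 1 else 0) else 0))"
    using cj by (intro sum.cong) auto
  also have "\<dots> = (if a = b then 1 else 0)"
    using ab j by (simp add: sum.distrib)
  finally show "(\<Sum>h = 1..m. ((if a = h then 1 else 0) + (if h = j then c a else 0))
        * ((if h = b then 1 else 0) - (if b = j then c h else 0))) = (if a = b then 1 else 0)" .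
next
  fix b assume b: "b \<in> {1..m}"
  have "(\<Sum>i = 1..m. Polynomial.smult ((if i = b then 1 else 0) + (if b = j then c i else 0)) (x i))
      = (\<Sum>i = 1..m. (if i = b then x b else 0) + (if b = j then Polynomial.smult (c i) (x i) else 0))"
    by (intro sum.cong) (auto simp: smult_add_left)
  also have "\<dots> = (x(j := x j + (\<Sum>i = 1..m. Polynomial.smult (c i) (x i)))) b"
    using b by (simp add: sum.distrib)
  finally show "(x(j := x j + (\<Sum>i = 1..m. Polynomial.smult (c i) (x i)))) b
      = (\<Sum>i = 1..m. Polynomial.smult ((if i = b then 1 else 0) + (if b = j then c i else 0)) (x i))" ..
next
  fix a assume a: "a \<in> {1..m}"
  have "(\<Sum>b = 1..m. Polynomial.smult ((if a = b then 1 else 0) + (if b = j then c a else 0))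
          (y b - Polynomial.smult (c b) (y j)))
      = (\<Sum>b = 1..m. (if b = a then y a - Polynomial.smult (c a) (y j) else 0)
          + (if b = j then Polynomial.smult (c a) (y j) else 0))"
    using cj by (intro sum.cong) (auto simp: smult_add_left)
  also have "\<dots> = y a" using a j by (simp add: sum.distrib)
  finally show "y a = (\<Sum>b = 1..m. Polynomial.smult ((if a = b then 1 else 0)
      + (if b = j then c a else 0)) (y b - Polynomial.smult (c b) (y j)))" ..
qed

text \<open>The same with x and y exchanged: Q = 1 - e_j c^T, whose inverse is 1 + e_j c^T, again
  because c_j = 0.\<close>

lemma eta_conjugate_dual_transvection:
  assumes j: "j \<in> {1..m}" and cj: "c j = 0"
  shows "GL_conjugate (m + 2) (eta m x y z)
    (eta m (\<lambda>i. x i - Polynomial.smult (c i) (x j))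
       (y(j := y j + (\<Sum>i = 1..m. Polynomial.smult (c i) (y i)))) z)"
proof (rule eta_conjugate[where q = "\<lambda>a b. (if a = b then 1 else 0) - (if a = j then c b else 0)"
      and r = "\<lambda>a b. (if a = b then 1 else 0) + (if a = j then c b else 0)"])
  fix a b assume ab: "a \<in> {1..m}" "b \<in> {1..m}"
  have "(\<Sum>h = 1..m. ((if a = h then 1 else 0) - (if a = j then c h else 0))
        * ((if h = b then 1 else 0) + (if h = j then c b else 0)))
      = (\<Sum>h = 1..m. (if h = b then (if a = b then 1 else 0) - (if a = j then c b else 0) else 0)
          + (if h = j then c b * (if a = j then 1 else 0) else 0))"
    using cj by (intro sum.cong) auto
  also have "\<dots> = (if a = b then 1 else 0)"
    using ab j by (simp add: sum.distrib)
  finally show "(\<Sum>h = 1..m. ((if a = h then 1 else 0) - (if a = j then c h else 0))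
        * ((if h = b then 1 else 0) + (if h = j then c b else 0))) = (if a = b then 1 else 0)" .
next
  fix b assume b: "b \<in> {1..m}"
  have "(\<Sum>i = 1..m. Polynomial.smult ((if i = b then 1 else 0) - (if i = j then c b else 0)) (x i))
      = (\<Sum>i = 1..m. (if i = b then x b else 0) - (if i = j then Polynomial.smult (c b) (x j) else 0))"
    by (intro sum.cong) (auto simp: smult_diff_left)
  also have "\<dots> = x b - Polynomial.smult (c b) (x j)"
    using b j by (simp add: sum_subtractf)
  finally show "x b - Polynomial.smult (c b) (x j)
      = (\<Sum>i = 1..m. Polynomial.smult ((if i = b then 1 else 0) - (if i = j then c b else 0)) (x i))" ..
next
  fix a assume a: "a \<in> {1..m}"
  let ?s = "\<Sum>i = 1..m. Polynomial.smult (c i) (y i)"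
  have "(\<Sum>b = 1..m. Polynomial.smult ((if a = b then 1 else 0) - (if a = j then c b else 0))
          ((y(j := y j + ?s)) b))
      = (\<Sum>b = 1..m. (if b = a then (y(j := y j + ?s)) a else 0)
          - (if a = j then Polynomial.smult (c b) (y b) else 0))"
    using cj by (intro sum.cong) (auto simp: smult_diff_left)
  also have "\<dots> = y a" using a by (simp add: sum_subtractf)
  finally show "y a = (\<Sum>b = 1..m. Polynomial.smult ((if a = b then 1 else 0)
      - (if a = j then c b else 0)) ((y(j := y j + ?s)) b))" ..
qed

text \<open>The inverse of a permutation matrix is its transpose, so the row x and the column y are
  permuted in the same way.\<close>

lemma eta_conjugate_permutation:
  assumes bij: "bij_betw \<pi> {1..m} {1..m}"
  shows "GL_conjugate (m + 2) (eta m x y z) (eta m (x \<circ> \<pi>) (y \<circ> \<pi>) z)"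
proof (rule eta_conjugate[where q = "\<lambda>a b. if a = \<pi> b then 1 else 0"
      and r = "\<lambda>a b. if b = \<pi> a then 1 else 0"])
  fix a b assume ab: "a \<in> {1..m}" "b \<in> {1..m}"
  have "(\<Sum>h = 1..m. (if a = \<pi> h then 1 else 0) * (if b = \<pi> h then 1 else 0))
      = (\<Sum>h = 1..m. (if a = h then 1 else 0) * (if b = h then 1 else (0 :: 'a)))"
    using bij by (rule sum.reindex_bij_betw)
  also have "\<dots> = (\<Sum>h = 1..m. if h = a then (if a = b then 1 else 0) else 0)"
    by (intro sum.cong) auto
  also have "\<dots> = (if a = b then 1 else 0)" using ab by simp
  finally show "(\<Sum>h = 1..m. (if a = \<pi> h then 1 else 0) * (if b = \<pi> h then 1 else 0))
      = (if a = b then 1 else (0 :: 'a))" .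
next
  fix j assume "j \<in> {1..m}"
  then have "\<pi> j \<in> {1..m}" using bij by (auto simp: bij_betw_def)
  then have "x (\<pi> j) = (\<Sum>i = 1..m. if i = \<pi> j then x i else 0)" by simp
  also have "\<dots> = (\<Sum>i = 1..m. Polynomial.smult (if i = \<pi> j then 1 else 0) (x i))"
    by (intro sum.cong) auto
  finally show "(x \<circ> \<pi>) j = (\<Sum>i = 1..m. Polynomial.smult (if i = \<pi> j then 1 else 0) (x i))" by simp
next
  fix i assume "i \<in> {1..m}"
  then have "y i = (\<Sum>h = 1..m. if h = i then y h else 0)" by simp
  also have "\<dots> = (\<Sum>j = 1..m. if \<pi> j = i then y (\<pi> j) else 0)"
    using bij by (rule sum.reindex_bij_betw[symmetric])
  also have "\<dots> = (\<Sum>j = 1..m. Polynomial.smult (if i = \<pi> j then 1 else 0) ((y \<circ> \<pi>) j))"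
    by (intro sum.cong) auto
  finally show "y i = (\<Sum>j = 1..m. Polynomial.smult (if i = \<pi> j then 1 else 0) ((y \<circ> \<pi>) j))" .
qed

subsection \<open>Reduction to independent coordinates\<close>

definition support :: "nat \<Rightarrow> (nat \<Rightarrow> 'k :: field poly) \<Rightarrow> nat set" where
  "support m x = {i \<in> {1..m}. x i \<noteq> 0}"

lemma support_finite [simp]: "finite (support m x)"
  by (simp add: support_def)

lemma card_support_le: "card (support m x) \<le> m"
proof -
  have "support m x \<subseteq> {1..m}" by (auto simp: support_def)
  then show ?thesis using card_mono[of "{1..m}" "support m x"] by simp
qed

text \<open>The relation is extended by zero to all of 1..m, the range of the sums in the
  transvection lemmas.\<close>

lemma lin_dep_supportE:
  assumes "\<not> lin_indep_family x (support m x)"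
  obtains c where "(\<Sum>i = 1..m. Polynomial.smult (c i) (x i)) = 0"
    "\<And>i. i \<notin> support m x \<Longrightarrow> c i = 0" "\<exists>j \<in> support m x. c j \<noteq> 0"
proof -
  obtain c where c: "(\<Sum>i\<in>support m x. Polynomial.smult (c i) (x i)) = 0"
      "\<exists>j \<in> support m x. c j \<noteq> 0"
    using assms by (auto simp: lin_indep_family_iff)
  let ?c = "\<lambda>i. if i \<in> support m x then c i else 0"
  have "(\<Sum>i = 1..m. Polynomial.smult (?c i) (x i)) = (\<Sum>i\<in>support m x. Polynomial.smult (c i) (x i))"
    by (rule sum.mono_neutral_cong_right) (auto simp: support_def)
  then show thesis using that[of ?c] c by auto
qed

text \<open>Dividing a relation by its coefficient at j gives the transvection that clears entry j.
  The coefficient at j itself is set to 0, as the transvection lemmas require.\<close>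

lemma isolate_term:
  fixes x :: "nat \<Rightarrow> 'k :: field poly"
  assumes "(\<Sum>i = 1..m. Polynomial.smult (c i) (x i)) = 0" "c j \<noteq> 0" "j \<in> {1..m}"
  shows "x j + (\<Sum>i = 1..m. Polynomial.smult (if i = j then 0 else c i / c j) (x i)) = 0"
proof -
  have "x j + (\<Sum>i = 1..m. Polynomial.smult (if i = j then 0 else c i / c j) (x i))
      = (\<Sum>i = 1..m. (if i = j then x i else 0)
          + Polynomial.smult (if i = j then 0 else c i / c j) (x i))"
    using assms(3) by (simp add: sum.distrib)
  also have "\<dots> = (\<Sum>i = 1..m. Polynomial.smult (1 / c j) (Polynomial.smult (c i) (x i)))"
    using assms(2) by (intro sum.cong) auto
  also have "\<dots> = Polynomial.smult (1 / c j) (\<Sum>i = 1..m. Polynomial.smult (c i) (x i))"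
    by (rule poly_vs.scale_sum_right[symmetric])
  finally show ?thesis using assms(1) by simp
qed

lemma eta_conjugate_independent:
  fixes x y :: "nat \<Rightarrow> 'k :: field poly"
  obtains x' y' where "GL_conjugate (m + 2) (eta m x y z) (eta m x' y' z)"
    "lin_indep_family x' (support m x')" "lin_indep_family y' (support m y')"
proof -
  let ?R = "\<lambda>(x', y'). GL_conjugate (m + 2) (eta m x y z) (eta m x' y' z)"
  \<comment> \<open>Eliminating an entry of \<open>x\<close> may fill up \<open>y\<close>, hence the weight \<open>m + 1\<close>.\<close>
  let ?w = "\<lambda>(x', y'). (m + 1) * card (support m x') + card (support m y')"
  have "?R (x, y)" using GL_conjugate_refl[OF eta_carrier] by simp
  then obtain v where v: "?R v" "\<And>u. ?R u \<Longrightarrow> ?w v \<le> ?w u"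
    using ex_has_least_nat[of ?R "(x, y)" ?w] by blast
  obtain x' y' where [simp]: "v = (x', y')" by (cases v)
  have R: "GL_conjugate (m + 2) (eta m x y z) (eta m x' y' z)" using v(1) by simp
  have least: "?w (x', y') \<le> ?w (x'', y'')"
    if "GL_conjugate (m + 2) (eta m x' y' z) (eta m x'' y'' z)" for x'' y''
    using v(2)[of "(x'', y'')"] GL_conjugate_trans[OF R that eta_carrier eta_carrier eta_carrier]
    by simp
  have "lin_indep_family x' (support m x')"
  proof (rule ccontr)
    assume "\<not> lin_indep_family x' (support m x')"
    then obtain c j where c: "(\<Sum>i = 1..m. Polynomial.smult (c i) (x' i)) = 0"
        and j: "j \<in> support m x'" "c j \<noteq> 0"
      by (auto elim: lin_dep_supportE)
    have jm: "j \<in> {1..m}" using j by (simp add: support_def)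
    let ?d = "\<lambda>i. if i = j then 0 else c i / c j"
    let ?y = "\<lambda>i. y' i - Polynomial.smult (?d i) (y' j)"
    have "GL_conjugate (m + 2) (eta m x' y' z) (eta m (x'(j := 0)) ?y z)"
      using eta_conjugate_transvection[OF jm, of ?d x' y' z] isolate_term[OF c j(2) jm] by simp
    from least[OF this]
    have "(m + 1) * card (support m x')
        \<le> (m + 1) * card (support m (x'(j := 0))) + card (support m ?y)" by simp
    also have "support m (x'(j := 0)) = support m x' - {j}" by (auto simp: support_def)
    \<comment> \<open>Even if all m entries of \<open>?y\<close> are nonzero, this does not make up
      for the weight m + 1 of the lost entry of \<open>x'\<close>.\<close>
    finally have "(m + 1) * card (support m x')
        \<le> (m + 1) * card (support m x' - {j}) + m" using card_support_le[of m ?y] by linarith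
    moreover have "card (support m x') = Suc (card (support m x' - {j}))"
      using card.remove[OF support_finite j(1)] .
    ultimately show False by simp
  qed
  moreover have "lin_indep_family y' (support m y')"
  proof (rule ccontr)
    assume "\<not> lin_indep_family y' (support m y')"
    then obtain c where c: "(\<Sum>i = 1..m. Polynomial.smult (c i) (y' i)) = 0"
        and c0: "\<And>i. i \<notin> support m y' \<Longrightarrow> c i = 0" and ex: "\<exists>j \<in> support m y'. c j \<noteq> 0"
      by (rule lin_dep_supportE) (rule that)
    \<comment> \<open>Eliminating a coordinate outside the support of \<open>x'\<close> leaves \<open>x'\<close> unchanged; if there is
      none in the relation, then the support of \<open>x'\<close> still does not grow.\<close>
    obtain j where j: "j \<in> support m y'" "c j \<noteq> 0"
        and j': "x' j = 0 \<or> (\<forall>i \<in> {1..m}. x' i = 0 \<longrightarrow> c i = 0)"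
    proof (cases "\<exists>j \<in> {1..m}. c j \<noteq> 0 \<and> x' j = 0")
      case True
      then show ?thesis using that c0 by blast
    next
      case False
      then show ?thesis using that ex by blast
    qed
    have jm: "j \<in> {1..m}" using j by (simp add: support_def)
    let ?d = "\<lambda>i. if i = j then 0 else c i / c j"
    let ?x = "\<lambda>i. x' i - Polynomial.smult (?d i) (x' j)"
    have "GL_conjugate (m + 2) (eta m x' y' z) (eta m ?x (y'(j := 0)) z)"
      using eta_conjugate_dual_transvection[OF jm, of ?d x' y' z] isolate_term[OF c j(2) jm]
      by simp
    from least[OF this]
    have "(m + 1) * card (support m x') + card (support m y')
        \<le> (m + 1) * card (support m ?x) + card (support m (y'(j := 0)))" by simp
    \<comment> \<open>If \<open>x' j = 0\<close>, then \<open>?x\<close> equals \<open>x'\<close>.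
      Otherwise \<open>c i = 0\<close> wherever \<open>x' i = 0\<close>, so no zero entry is
      filled.\<close>
    moreover have "support m ?x \<subseteq> support m x'"
      using j' by (auto simp: support_def)
    then have "(m + 1) * card (support m ?x) \<le> (m + 1) * card (support m x')"
      by (intro mult_le_mono2 card_mono) auto
    moreover have "support m (y'(j := 0)) = support m y' - {j}" by (auto simp: support_def)
    moreover have "card (support m y') = Suc (card (support m y' - {j}))"
      using card.remove[OF support_finite j(1)] .
    ultimately show False by simp
  qed
  ultimately show thesis using that R by blast
qed

section \<open>Sorting the coordinates by their supports\<close>

lemma sorting_permutation:
  assumes dis: "A \<inter> B = {}" "A \<inter> C = {}" "B \<inter> C = {}" and sub: "A \<union> B \<union> C \<subseteq> {1..m}"
  obtains \<pi> where "bij_betw \<pi> {1..m} {1..m}"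
    "\<And>i. i \<in> {1..m} \<Longrightarrow> \<pi> i \<in> A \<longleftrightarrow> i \<le> card A"
    "\<And>i. i \<in> {1..m} \<Longrightarrow> \<pi> i \<in> B \<longleftrightarrow> card A < i \<and> i \<le> card A + card B"
    "\<And>i. i \<in> {1..m} \<Longrightarrow> \<pi> i \<in> C \<longleftrightarrow> card A + card B < i \<and> i \<le> card A + card B + card C"
proof -
  define D where "D = {1..m} - (A \<union> B \<union> C)"
  have fin: "finite A" "finite B" "finite C" "finite D"
    using sub finite_subset[of _ "{1..m}"] by (auto simp: D_def)
  obtain as bs cs ds where s: "set as = A" "set bs = B" "set cs = C" "set ds = D"
    and d: "distinct as" "distinct bs" "distinct cs" "distinct ds"
    using fin by (meson finite_distinct_list)
  have len: "length as = card A" "length bs = card B" "length cs = card C"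
    using d[THEN distinct_card] s by simp_all
  \<comment> \<open>The permutation reads off this list, which runs through A, B, C and then the
    remaining indices; the list is indexed from 0, whence the shift by one in
    \<open>\<pi>\<close>.\<close>
  let ?L = "as @ bs @ cs @ ds"
  have dL: "distinct ?L" using s d dis by (auto simp: D_def)
  have sL: "set ?L = {1..m}" using s sub by (auto simp: D_def)
  have lL: "length ?L = m" using distinct_card[OF dL] sL by simp
  define \<pi> where "\<pi> i = ?L ! (i - 1)" for i
  have "bij_betw (\<lambda>i. i - 1) {1..m} {..<m}"
    by (rule bij_betw_byWitness[where f' = Suc]) auto
  from bij_betw_trans[OF this bij_betw_nth[OF dL, of "{..<m}" "{1..m}"]] lL sL
  have bij: "bij_betw \<pi> {1..m} {1..m}" by (simp add: \<pi>_def[abs_def] comp_def)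
  have val: "(i \<le> card A \<longrightarrow> \<pi> i \<in> A) \<and> (card A < i \<and> i \<le> card A + card B \<longrightarrow> \<pi> i \<in> B) \<and>
      (card A + card B < i \<and> i \<le> card A + card B + card C \<longrightarrow> \<pi> i \<in> C) \<and>
      (card A + card B + card C < i \<longrightarrow> \<pi> i \<in> D)" if "i \<in> {1..m}" for i
  proof -
    define k where "k = i - 1"
    have k: "i = Suc k" "k < length ?L" using that unfolding lL k_def by auto
    show ?thesis
      unfolding \<pi>_def len[symmetric] unfolding s[symmetric] using k
      by (auto simp: nth_append)
  qed
  \<comment> \<open>Disjointness turns the implications in \<open>val\<close> into the required
    equivalences.\<close>
  have excl: "v \<in> A \<Longrightarrow> v \<notin> B \<and> v \<notin> C" "v \<in> B \<Longrightarrow> v \<notin> A \<and> v \<notin> C"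
      "v \<in> C \<Longrightarrow> v \<notin> A \<and> v \<notin> B" "v \<in> D \<Longrightarrow> v \<notin> A \<and> v \<notin> B \<and> v \<notin> C" for v
    using dis by (auto simp: D_def)
  have "(\<pi> i \<in> A \<longleftrightarrow> i \<le> card A) \<and> (\<pi> i \<in> B \<longleftrightarrow> card A < i \<and> i \<le> card A + card B) \<and>
      (\<pi> i \<in> C \<longleftrightarrow> card A + card B < i \<and> i \<le> card A + card B + card C)" if "i \<in> {1..m}" for i
  proof -
    consider "i \<le> card A" | "card A < i" "i \<le> card A + card B"
      | "card A + card B < i" "i \<le> card A + card B + card C" | "card A + card B + card C < i"
      by linarith
    then show ?thesis
    proof cases
      case 1
      then show ?thesis using val[OF that] excl(1)[of "\<pi> i"] by simp
    next
      case 2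
      then show ?thesis using val[OF that] excl(2)[of "\<pi> i"] by simp
    next
      case 3
      then show ?thesis using val[OF that] excl(3)[of "\<pi> i"] by simp
    next
      case 4
      then show ?thesis using val[OF that] excl(4)[of "\<pi> i"] by simp
    qed
  qed
  with bij show thesis using that[of \<pi>] by simp
qed

lemma lin_indep_family_reindex:
  assumes "lin_indep_family x J" "inj_on g I" "g ` I \<subseteq> J" "\<And>i. i \<in> I \<Longrightarrow> a i = x (g i)"
  shows "lin_indep_family a I"
proof -
  have im: "a ` I = x ` g ` I" using assms(4) by (auto simp: image_iff)
  have "inj_on (x \<circ> g) I"
    using assms by (auto simp: lin_indep_family_def intro: comp_inj_on inj_on_subset)
  then have "inj_on a I" using assms(4) by (simp add: inj_on_def)
  moreover have "poly_vs.independent (a ` I)"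
    unfolding im
    by (rule poly_vs.independent_mono[OF conjunct2[OF assms(1)[unfolded lin_indep_family_def]]])
      (use assms(3) in blast)
  ultimately show ?thesis by (simp add: lin_indep_family_def)
qed

text \<open>Packs x, y, z into the single sequence expected by \<open>eta_seq\<close>. The values at
  0 and beyond 2m + 1 never enter the matrix.\<close>

definition coords :: "nat \<Rightarrow> (nat \<Rightarrow> 'k :: field poly) \<Rightarrow> (nat \<Rightarrow> 'k poly) \<Rightarrow> 'k poly \<Rightarrow> nat \<Rightarrow> 'k poly"
  where "coords m x y z i = (if i \<le> m then x i else if i \<le> 2 * m then y (i - m) else z)"

lemma eta_seq_coords: "eta_seq m (coords m x y z) = eta m x y z"
  by (rule eq_matI) (auto simp: eta_seq_def eta_def coords_def)

lemma heisenberg_leads_to: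
  "leads_to (m + 2) (heisenberg m :: 'k :: field poly mat set)
     (daleth m \<union> (\<Union>t \<in> Omega m. heisenberg_sub m t))"
  unfolding leads_to_def
proof
  fix A :: "'k poly mat" assume "A \<in> heisenberg m"
  then obtain x0 y0 z where A: "A = eta m x0 y0 z" by (auto simp: heisenberg_def)
  obtain x y where xy: "GL_conjugate (m + 2) A (eta m x y z)"
      and ix: "lin_indep_family x (support m x)" and iy: "lin_indep_family y (support m y)"
    unfolding A by (rule eta_conjugate_independent)
  let ?S = "support m x" and ?U = "support m y" and ?T = "daleth m \<union> (\<Union>t \<in> Omega m. heisenberg_sub m t)"
  have "\<exists>\<pi>. bij_betw \<pi> {1..m} {1..m} \<and> eta m (x \<circ> \<pi>) (y \<circ> \<pi>) z \<in> ?T"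
  proof (cases "?S \<inter> ?U = {}")
    case True
    \<comment> \<open>Indices outside the support of x are placed first. Then x can be nonzero only
      at positions after \<open>card ?B\<close>, and y only at positions up to
      \<open>card ?B\<close>.\<close>
    let ?B = "{1..m} - ?S"
    obtain \<pi> where bij: "bij_betw \<pi> {1..m} {1..m}"
      and \<pi>: "\<And>i. i \<in> {1..m} \<Longrightarrow> \<pi> i \<in> ?B \<longleftrightarrow> i \<le> card ?B"
      by (rule sorting_permutation[of ?B "{}" "{}" m]) auto
    have \<pi>m: "\<pi> i \<in> {1..m}" if "i \<in> {1..m}" for i
      using bij that by (auto simp: bij_betw_def)
    have x0: "x (\<pi> i) = 0" if "i \<in> {1..m}" "i \<le> card ?B" for i
      using \<pi>[of i] \<pi>m[of i] that by (auto simp: support_def)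
    have y0: "y (\<pi> i) = 0" if "i \<in> {1..m}" "card ?B < i" for i
      using \<pi>[of i] \<pi>m[of i] that True by (auto simp: support_def)
    have Bm: "card ?B \<le> m" using card_mono[of "{1..m}" ?B] by auto
    have c0: "coords m (x \<circ> \<pi>) (y \<circ> \<pi>) z j = 0"
      if "j \<in> {1..2 * m + 1}" "j \<notin> {card ?B + 1..m + (card ?B + 1) - 1} \<union> {2 * m + 1}" for j
      using that Bm x0[of j] y0[of "j - m"] by (auto simp: coords_def)
    \<comment> \<open>In the combined sequence the two ranges, \<open>card ?B + 1\<close> to m and m
      + 1 to \<open>m + card ?B\<close>, join to one window of length m. If x = 0 on 1..m, its
      starting index is m + 1, the largest one allowed.\<close>
    have "eta m (x \<circ> \<pi>) (y \<circ> \<pi>) z \<in> daleth_comp m (card ?B + 1)"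
      unfolding daleth_comp_def mem_Collect_eq
      by (intro exI[of _ "coords m (x \<circ> \<pi>) (y \<circ> \<pi>) z"] conjI ballI impI eta_seq_coords[symmetric] c0)
    then have "eta m (x \<circ> \<pi>) (y \<circ> \<pi>) z \<in> daleth m"
      unfolding daleth_def by (rule UN_I[rotated]) (use Bm in simp)
    with bij show ?thesis by blast
  next
    case False
    define l r1 r2 where "l = card ?S" and "r1 = card (?S \<inter> ?U)" and "r2 = card (?U - ?S)"
    have sub: "?S \<subseteq> {1..m}" "?U \<subseteq> {1..m}" by (auto simp: support_def)
    have l: "l = r1 + card (?S - ?U)"
      unfolding l_def r1_def by (rule card_Int_Diff) simp
    then have rl: "r1 \<le> l" by simp
    have "l + r2 = card (?S \<union> (?U - ?S))"
      unfolding l_def r2_def by (rule card_Un_disjoint[symmetric]) auto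
    also have "\<dots> \<le> m" using card_mono[of "{1..m}" "?S \<union> (?U - ?S)"] sub by auto
    finally have lr: "l + r2 \<le> m" .
    have r1: "r1 \<ge> 1" using False by (simp add: r1_def Suc_le_eq card_gt_0_iff)
    have dis: "?S \<inter> ?U \<inter> (?S - ?U) = {}" "?S \<inter> ?U \<inter> (?U - ?S) = {}" "(?S - ?U) \<inter> (?U - ?S) = {}"
      by auto
    have "?S \<inter> ?U \<union> (?S - ?U) \<union> (?U - ?S) \<subseteq> {1..m}" using sub by auto
    \<comment> \<open>The order is: indices in both supports, then those only in the support of x,
      then those only in the support of y. So x lives on 1..l, and y on 1..r1 and l + 1..l +
      r2.\<close>
    from sorting_permutation[OF dis this] obtain \<pi> where bij: "bij_betw \<pi> {1..m} {1..m}"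
      and p: "\<And>i. i \<in> {1..m} \<Longrightarrow> \<pi> i \<in> ?S \<inter> ?U \<longleftrightarrow> i \<le> r1"
        "\<And>i. i \<in> {1..m} \<Longrightarrow> \<pi> i \<in> ?S - ?U \<longleftrightarrow> r1 < i \<and> i \<le> l"
        "\<And>i. i \<in> {1..m} \<Longrightarrow> \<pi> i \<in> ?U - ?S \<longleftrightarrow> l < i \<and> i \<le> l + r2"
      unfolding l r1_def r2_def by metis
    have inj: "inj_on \<pi> {1..m}" and \<pi>m: "\<And>i. i \<in> {1..m} \<Longrightarrow> \<pi> i \<in> {1..m}"
      using bij by (auto simp: bij_betw_def)
    have S: "\<pi> i \<in> ?S \<longleftrightarrow> i \<le> l" if "i \<in> {1..m}" for i
      using p(1,2)[OF that] l by auto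
    have U: "\<pi> i \<in> ?U \<longleftrightarrow> i \<le> r1 \<or> (l < i \<and> i \<le> l + r2)" if "i \<in> {1..m}" for i
      using p(1,3)[OF that] by auto
    let ?a = "coords m (x \<circ> \<pi>) (y \<circ> \<pi>) z"
    have x0: "x (\<pi> i) = 0" if "i \<in> {1..m}" "l < i" for i
      using S[of i] \<pi>m[of i] that by (auto simp: support_def)
    have y0: "y (\<pi> i) = 0" if "i \<in> {1..m}" "r1 < i" "i \<le> l \<or> l + r2 < i" for i
      using U[of i] \<pi>m[of i] that by (auto simp: support_def)
    have "lin_indep_family ?a {1..l}"
    proof (rule lin_indep_family_reindex[OF ix])
      show "inj_on \<pi> {1..l}" using inj lr by (auto intro: inj_on_subset)
      show "\<pi> ` {1..l} \<subseteq> ?S" using S lr by auto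
    qed (use lr in \<open>auto simp: coords_def\<close>)
    moreover have "lin_indep_family ?a ({m + 1..m + r1} \<union> {m + l + 1..m + l + r2})"
    proof (rule lin_indep_family_reindex[OF iy])
      let ?J = "{m + 1..m + r1} \<union> {m + l + 1..m + l + r2}"
      have J: "m < j" "j - m \<in> {1..m}" "j - m \<le> r1 \<or> l < j - m \<and> j - m \<le> l + r2"
        if "j \<in> ?J" for j
        using that lr rl by auto
      \<comment> \<open>The entries of y are stored with offset m, so position j of the sequence
        corresponds to coordinate \<open>\<pi> (j - m)\<close>.\<close>
      show "inj_on (\<lambda>j. \<pi> (j - m)) ?J"
      proof (rule inj_onI)
        fix i j assume ij: "i \<in> ?J" "j \<in> ?J" and "\<pi> (i - m) = \<pi> (j - m)"
        then have "i - m = j - m" using inj J(2) by (meson inj_onD)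
        then show "i = j" using J(1)[OF ij(1)] J(1)[OF ij(2)] by linarith
      qed
      show "(\<lambda>j. \<pi> (j - m)) ` ?J \<subseteq> ?U"
      proof (rule image_subsetI)
        fix j assume "j \<in> ?J"
        then show "\<pi> (j - m) \<in> ?U" using U[OF J(2)] J(3) by blast
      qed
    qed (use lr rl in \<open>auto simp: coords_def\<close>)
    moreover have "?a i = 0"
      if "i \<in> {l + 1..m} \<union> {m + r1 + 1..m + l} \<union> {m + l + r2 + 1..2 * m}" for i
    proof (cases "i \<le> m")
      case True
      with that rl have "i \<in> {1..m}" "l < i" by auto
      with True x0 show ?thesis by (simp add: coords_def)
    next
      case False
      with that lr rl have "i - m \<in> {1..m}" "r1 < i - m" "i - m \<le> l \<or> l + r2 < i - m" "i \<le> 2 * m"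
        by auto
      with False y0 show ?thesis by (simp add: coords_def)
    qed
    ultimately have "eta m (x \<circ> \<pi>) (y \<circ> \<pi>) z \<in> heisenberg_sub m (l, r1, r2)"
      by (auto simp: heisenberg_sub_def eta_seq_coords intro!: exI[of _ ?a])
    moreover have "(l, r1, r2) \<in> Omega m" using lr rl r1 by (auto simp: Omega_def)
    ultimately show ?thesis using bij by blast
  qed
  then obtain \<pi> where \<pi>: "bij_betw \<pi> {1..m} {1..m}" "eta m (x \<circ> \<pi>) (y \<circ> \<pi>) z \<in> ?T" by blast
  have "GL_conjugate (m + 2) A (eta m (x \<circ> \<pi>) (y \<circ> \<pi>) z)"
    using xy eta_conjugate_permutation[OF \<pi>(1)] unfolding A
    by (rule GL_conjugate_trans[OF _ _ eta_carrier eta_carrier eta_carrier])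
  from GL_conjugate_leads[OF this[unfolded A] eta_carrier eta_carrier] \<pi>(2)
  show "\<exists>P \<in> GL (m + 2). const_mat (GL_inv (m + 2) P) * A * const_mat P \<in> ?T"
    unfolding A by metis
qed

theorem theorem2p1:
  fixes p m :: nat
  assumes "CHAR('k :: field) = p" and "p > 0" and "m \<ge> 1"
  shows "leads_to (m + 2) (heisenberg m :: 'k poly mat set)
           (daleth m \<union> (\<Union>t \<in> Omega m. heisenberg_sub m t)) \<and>
         mutually_GL_disjoint (m + 2)
           [daleth m :: 'k poly mat set, \<Union>t \<in> Omega m. heisenberg_sub m t]"
  using heisenberg_leads_to mutually_GL_disjoint_daleth_heisenberg_sub by blast

end
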